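(* Let $(L,[\cdot,\cdot]_L,\alpha)$ be a regular hom-Lie superalgebra and let $N\in C^1_\alpha(L;L)$ be a hom-Nijienhuis operator. Then a deformation of the regular hom-Lie superalgebra $(L,[\cdot,\cdot]_L,\alpha)$ can be obtained by putting $$\psi(u,v)=d_{-1}N(u,v)=[u,v]_N,\qquad u,v\in L$$ (that is, $\psi$ generates a deformation). Furthermore, this deformation is trivial.
   Context: A hom-Lie superalgebra is a triple $(L,[\cdot,\cdot]_L,\alpha)$ with $L=L_{\bar 0}\oplus L_{\bar 1}$ a $\mathbb Z_2$-graded vector space over a field ($|x|$ denotes the degree of a homogeneous element $x$), $[\cdot,\cdot]_L:L\times L\to L$ an even bilinear map and $\alpha:L\to L$ an even linear map such that for all homogeneous $x,y,z$: $[x,y]_L=-(-1)^{|x||y|}[y,x]_L$ and $$(-1)^{|x||z|}[\alpha(x),[y,z]_L]_L+(-1)^{|y||x|}[\alpha(y),[z,x]_L]_L+(-1)^{|z||y|}[\alpha(z),[x,y]_L]_L=0.$$ It is regular if $\alpha$ is an algebra automorphism (bijective and $\alpha([x,y]_L)=[\alpha(x),\alpha(y)]_L$). $C^k_\alpha(L;L)$ is the set of $k$-linear super-skew-symmetric maps $f:L^k\to L$ commuting with $\alpha$, i.e. $\alpha(f(u_1,\dots,u_k))=f(\alpha(u_1),\dots,\alpha(u_k))$; in particular $C^1_\alpha(L;L)$ consists of linear maps $N:L\to L$ with $N\alpha=\alpha N$. The coboundary operator $d_{-1}:C^1_\alpha(L;L)\to C^2_\alpha(L;L)$ associated with the $\alpha^{-1}$-adjoint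 representation $\mathrm{ad}_{-1}(u)(v)=[\alpha^{-1}(u),v]_L$ is given, for homogeneous $f$ of degree $|f|$ and homogeneous $u,v$, by $$d_{-1}f(u,v)=(-1)^{|f||u|}[u,f(v)]_L-(-1)^{(|f|+|u|)|v|}[v,f(u)]_L-f([u,v]_L).$$ A linear operator $N\in C^1_\alpha(L;L)$ is a hom-Nijienhuis operator if $[Nu,Nv]_L=N[u,v]_N$ for all $u,v\in L$, where $[u,v]_N:=[Nu,v]_L+[u,Nv]_L-N[u,v]_L$. For $\psi\in C^2_\alpha(L;L)$ put $[u,v]_t=[u,v]_L+t\psi(u,v)$, where $t$ is a parameter. One says that $\psi$ generates a deformation of the regular hom-Lie superalgebra $(L,[\cdot,\cdot]_L,\alpha)$ if all the brackets $[\cdot,\cdot]_t$ make $(L,[\cdot,\cdot]_t,\alpha)$ a regular hom-Lie superalgebra. The deformation is trivial if there is a linear operator $N\in C^1_\alpha(L;L)$ such that, with $T_t=\mathrm{Id}+tN$, one has $T_t[u,v]_t=[T_t(u),T_t(v)]_L$ for all $u,v\in L$.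
   Formalization: The operator N is additionally assumed to be even (degree 0); without this the claim fails, e.g. even x,y,z, odd w, [x,y]=z, α=Id, Nz=w, N=0 otherwise, where [x,y]_t = z − t w is not even. *)

theory Defs
  imports Complex_Main "HOL-Library.Z2"
begin

text \<open>Degrees live in the two-element field \<^typ>\<open>bit\<close>; \<open>ksign i\<close> is the sign \<open>(-1)\<^sup>i\<close> in the ground field.\<close>

definition ksign :: "bit \<Rightarrow> 'k::field" where
  "ksign i = (if i = 0 then 1 else - 1)"

locale super_vector_space = vector_space scale
  for scale :: "'k::field \<Rightarrow> 'v::ab_group_add \<Rightarrow> 'v" +
  fixes V :: "bit \<Rightarrow> 'v set"
  assumes subspace_V: "subspace (V i)"
    and V_disjoint: "V 0 \<inter> V 1 = {0}"
    and V_decompose: "\<exists>a\<in>V 0. \<exists>b\<in>V 1. x = a + b"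

definition bilinear_op :: "('k::field \<Rightarrow> 'v::ab_group_add \<Rightarrow> 'v) \<Rightarrow> ('v \<Rightarrow> 'v \<Rightarrow> 'v) \<Rightarrow> bool" where
  "bilinear_op scale f \<longleftrightarrow>
     (\<forall>u. Vector_Spaces.linear scale scale (\<lambda>v. f u v)) \<and>
     (\<forall>v. Vector_Spaces.linear scale scale (\<lambda>u. f u v))"

definition map_of_degree :: "(bit \<Rightarrow> 'v set) \<Rightarrow> bit \<Rightarrow> ('v \<Rightarrow> 'v) \<Rightarrow> bool" where
  "map_of_degree V p f \<longleftrightarrow> (\<forall>i. \<forall>u\<in>V i. f u \<in> V (p + i))"

definition super_skew :: "('k::field \<Rightarrow> 'v::ab_group_add \<Rightarrow> 'v) \<Rightarrow> (bit \<Rightarrow> 'v set) \<Rightarrow> ('v \<Rightarrow> 'v \<Rightarrow> 'v) \<Rightarrow> bool" where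
  "super_skew scale V f \<longleftrightarrow>
     (\<forall>i j. \<forall>u\<in>V i. \<forall>v\<in>V j. f u v = - scale (ksign (i * j)) (f v u))"

locale hom_Lie_superalgebra = super_vector_space scale V
  for scale :: "'k::field \<Rightarrow> 'v::ab_group_add \<Rightarrow> 'v"
    and V :: "bit \<Rightarrow> 'v set" +
  fixes br :: "'v \<Rightarrow> 'v \<Rightarrow> 'v"
    and \<alpha> :: "'v \<Rightarrow> 'v"
  assumes br_bilinear: "bilinear_op scale br"
    and br_even: "u \<in> V i \<Longrightarrow> v \<in> V j \<Longrightarrow> br u v \<in> V (i + j)"
    and \<alpha>_linear: "Vector_Spaces.linear scale scale \<alpha>"
    and \<alpha>_even: "map_of_degree V 0 \<alpha>"
    and br_skew: "super_skew scale V br"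
    and hom_Jacobi: "x \<in> V i \<Longrightarrow> y \<in> V j \<Longrightarrow> z \<in> V k \<Longrightarrow>
        scale (ksign (i * k)) (br (\<alpha> x) (br y z)) +
        scale (ksign (j * i)) (br (\<alpha> y) (br z x)) +
        scale (ksign (k * j)) (br (\<alpha> z) (br x y)) = 0"

locale regular_hom_Lie_superalgebra = hom_Lie_superalgebra scale V br \<alpha>
  for scale :: "'k::field \<Rightarrow> 'v::ab_group_add \<Rightarrow> 'v"
    and V :: "bit \<Rightarrow> 'v set"
    and br :: "'v \<Rightarrow> 'v \<Rightarrow> 'v"
    and \<alpha> :: "'v \<Rightarrow> 'v" +
  assumes \<alpha>_bij: "bij \<alpha>"
    and \<alpha>_mult: "\<alpha> (br u v) = br (\<alpha> u) (\<alpha> v)"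

definition cochains1 :: "('k::field \<Rightarrow> 'v::ab_group_add \<Rightarrow> 'v) \<Rightarrow> ('v \<Rightarrow> 'v) \<Rightarrow> ('v \<Rightarrow> 'v) set" where
  "cochains1 scale \<alpha> = {f. Vector_Spaces.linear scale scale f \<and> (\<forall>u. \<alpha> (f u) = f (\<alpha> u))}"

definition cochains2 ::
  "('k::field \<Rightarrow> 'v::ab_group_add \<Rightarrow> 'v) \<Rightarrow> (bit \<Rightarrow> 'v set) \<Rightarrow> ('v \<Rightarrow> 'v) \<Rightarrow> ('v \<Rightarrow> 'v \<Rightarrow> 'v) set" where
  "cochains2 scale V \<alpha> =
     {f. bilinear_op scale f \<and> super_skew scale V f \<and> (\<forall>u v. \<alpha> (f u v) = f (\<alpha> u) (\<alpha> v))}"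

definition component :: "(bit \<Rightarrow> 'v::ab_group_add set) \<Rightarrow> bit \<Rightarrow> 'v \<Rightarrow> 'v" where
  "component V i x = (THE y. y \<in> V i \<and> x - y \<in> V (i + 1))"

definition map_component :: "(bit \<Rightarrow> 'v::ab_group_add set) \<Rightarrow> bit \<Rightarrow> ('v \<Rightarrow> 'v) \<Rightarrow> 'v \<Rightarrow> 'v" where
  "map_component V p f u = (\<Sum>i\<in>{0, 1}. component V (p + i) (f (component V i u)))"

text \<open>
  The coboundary operator \<open>d\<^sub>-\<^sub>1\<close> of the \<open>\<alpha>\<^sup>-\<^sup>1\<close>-adjoint representation on 1-cochains.
  \<open>coboundary_hom\<close> is the defining formula for homogeneous arguments \<open>f, u, v\<close> of degrees
  \<open>p, i, j\<close>; \<open>coboundary\<close> is its extension to arbitrary arguments by linearity in \<open>f\<close>, \<open>u\<close>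
  and \<open>v\<close>. The map \<open>\<alpha>\<close> does not occur: the action of \<open>\<alpha> u\<close> is \<open>[\<alpha>\<^sup>-\<^sup>1 (\<alpha> u), v] = [u, v]\<close>.
\<close>

definition coboundary_hom ::
  "('k::field \<Rightarrow> 'v::ab_group_add \<Rightarrow> 'v) \<Rightarrow> ('v \<Rightarrow> 'v \<Rightarrow> 'v) \<Rightarrow>
   bit \<Rightarrow> bit \<Rightarrow> bit \<Rightarrow> ('v \<Rightarrow> 'v) \<Rightarrow> 'v \<Rightarrow> 'v \<Rightarrow> 'v" where
  "coboundary_hom scale br p i j f u v =
     scale (ksign (p * i)) (br u (f v))
     - scale (ksign ((p + i) * j)) (br v (f u))
     - f (br u v)"

definition coboundary ::
  "('k::field \<Rightarrow> 'v::ab_group_add \<Rightarrow> 'v) \<Rightarrow> (bit \<Rightarrow> 'v set) \<Rightarrow> ('v \<Rightarrow> 'v \<Rightarrow> 'v) \<Rightarrow>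
   ('v \<Rightarrow> 'v) \<Rightarrow> 'v \<Rightarrow> 'v \<Rightarrow> 'v" where
  "coboundary scale V br f u v =
     (\<Sum>p\<in>{0, 1}. \<Sum>i\<in>{0, 1}. \<Sum>j\<in>{0, 1}.
        coboundary_hom scale br p i j (map_component V p f) (component V i u) (component V j v))"

definition nijenhuis_bracket ::
  "('v::ab_group_add \<Rightarrow> 'v \<Rightarrow> 'v) \<Rightarrow> ('v \<Rightarrow> 'v) \<Rightarrow> 'v \<Rightarrow> 'v \<Rightarrow> 'v" where
  "nijenhuis_bracket br N u v = br (N u) v + br u (N v) - N (br u v)"

definition hom_Nijenhuis ::
  "('k::field \<Rightarrow> 'v::ab_group_add \<Rightarrow> 'v) \<Rightarrow> ('v \<Rightarrow> 'v \<Rightarrow> 'v) \<Rightarrow> ('v \<Rightarrow> 'v) \<Rightarrow> ('v \<Rightarrow> 'v) \<Rightarrow> bool" where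
  "hom_Nijenhuis scale br \<alpha> N \<longleftrightarrow>
     N \<in> cochains1 scale \<alpha> \<and> (\<forall>u v. br (N u) (N v) = N (nijenhuis_bracket br N u v))"

definition deformed_bracket ::
  "('k::field \<Rightarrow> 'v::ab_group_add \<Rightarrow> 'v) \<Rightarrow> ('v \<Rightarrow> 'v \<Rightarrow> 'v) \<Rightarrow> ('v \<Rightarrow> 'v \<Rightarrow> 'v) \<Rightarrow>
   'k \<Rightarrow> 'v \<Rightarrow> 'v \<Rightarrow> 'v" where
  "deformed_bracket scale br \<psi> t u v = br u v + scale t (\<psi> u v)"

definition generates_deformation ::
  "('k::field \<Rightarrow> 'v::ab_group_add \<Rightarrow> 'v) \<Rightarrow> (bit \<Rightarrow> 'v set) \<Rightarrow> ('v \<Rightarrow> 'v \<Rightarrow> 'v) \<Rightarrow> ('v \<Rightarrow> 'v) \<Rightarrow>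
   ('v \<Rightarrow> 'v \<Rightarrow> 'v) \<Rightarrow> bool" where
  "generates_deformation scale V br \<alpha> \<psi> \<longleftrightarrow>
     \<psi> \<in> cochains2 scale V \<alpha> \<and>
     (\<forall>t. regular_hom_Lie_superalgebra scale V (deformed_bracket scale br \<psi> t) \<alpha>)"

definition trivial_deformation ::
  "('k::field \<Rightarrow> 'v::ab_group_add \<Rightarrow> 'v) \<Rightarrow> ('v \<Rightarrow> 'v \<Rightarrow> 'v) \<Rightarrow> ('v \<Rightarrow> 'v) \<Rightarrow>
   ('v \<Rightarrow> 'v \<Rightarrow> 'v) \<Rightarrow> bool" where
  "trivial_deformation scale br \<alpha> \<psi> \<longleftrightarrow>
     (\<exists>N\<in>cochains1 scale \<alpha>. \<forall>t u v.
        (let T = (\<lambda>x. x + scale t (N x)) in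
           T (deformed_bracket scale br \<psi> t u v) = br (T u) (T v)))"

context super_vector_space
begin

lemma component_unique:
  assumes "y \<in> V i" "x - y \<in> V (i + 1)"
  shows "component V i x = y"
  unfolding component_def
proof (rule the_equality)
  show "y \<in> V i \<and> x - y \<in> V (i + 1)" using assms by simp
  fix z assume z: "z \<in> V i \<and> x - z \<in> V (i + 1)"
  have "z - y \<in> V i" using z assms subspace_V[of i] by (auto intro: subspace_diff)
  moreover have "(x - y) - (x - z) \<in> V (i + 1)"
    using z assms(2) subspace_diff[OF subspace_V] by blast
  then have "z - y \<in> V (i + 1)" by simp
  ultimately have "z - y \<in> V 0 \<inter> V 1" by (cases i) auto
  then show "z = y" using V_disjoint by auto
qed

lemma zero_in_V: "0 \<in> V i"
  using subspace_V subspace_0 by blast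

lemma component_homogeneous:
  assumes "u \<in> V i"
  shows "component V j u = (if j = i then u else 0)"
proof (cases "j = i")
  case True
  then show ?thesis using component_unique[of u i u] assms zero_in_V by simp
next
  case False
  then have "j + 1 = i" by (cases i; cases j) auto
  then show ?thesis using component_unique[of 0 j u] assms zero_in_V False by simp
qed

lemma map_component_homogeneous:
  assumes "Vector_Spaces.linear scale scale f" "map_of_degree V p f"
  shows "map_component V q f = (if q = p then f else (\<lambda>u. 0))"
proof
  fix u
  interpret f: Vector_Spaces.linear scale scale f by fact
  obtain a b where ab: "a \<in> V 0" "b \<in> V 1" "u = a + b" using V_decompose by blast
  have c: "component V 0 u = a" "component V 1 u = b"
    using ab by (auto intro: component_unique)
  have "f a \<in> V (p + 0)" "f b \<in> V (p + 1)"
    using assms(2) ab unfolding map_of_degree_def by blast+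
  then show "map_component V q f u = (if q = p then f else (\<lambda>u. 0)) u"
    by (cases p; cases q)
      (simp_all add: map_component_def c component_homogeneous ab(3)[THEN arg_cong[of _ _ f]] f.add)
qed

end

text \<open>On homogeneous arguments the extended operator is given by the defining formula.\<close>

lemma (in hom_Lie_superalgebra) coboundary_homogeneous:
  assumes f: "Vector_Spaces.linear scale scale f" "map_of_degree V p f"
    and uv: "u \<in> V i" "v \<in> V j"
  shows "coboundary scale V br f u v =
     scale (ksign (p * i)) (br u (f v))
     - scale (ksign ((p + i) * j)) (br v (f u))
     - f (br u v)"
proof -
  interpret f: Vector_Spaces.linear scale scale f by fact
  have l: "br x 0 = 0" "br 0 x = 0" for x
    using br_bilinear linear_0 unfolding bilinear_op_def
    by (metis (no_types) module_hom.zero module_hom_iff_linear)+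
  show ?thesis
    unfolding coboundary_def map_component_homogeneous[OF f]
      component_homogeneous[OF uv(1)] component_homogeneous[OF uv(2)]
    by (cases p; cases i; cases j) (simp_all add: coboundary_hom_def l f.zero)
qed

end

theory Submission
  imports Defs
begin

text \<open>
  Write \<open>K x y z = [\<alpha> x, [y, z]]\<close> and let \<open>J\<close> be its signed cyclic sum, so that the hom-Jacobi
  identity says that \<open>J\<close> vanishes on homogeneous arguments. Since \<open>N\<close> is even and \<open>br\<close> is
  super-skew-symmetric, the coboundary of \<open>N\<close> is the Nijenhuis bracket \<open>\<psi>\<close>: moving \<open>N u\<close> past
  \<open>v\<close> costs the same sign as moving \<open>u\<close> past \<open>v\<close>.

  The only substantial point is the hom-Jacobi identity for \<open>[u, v]\<^sub>t = [u, v] + t \<psi>(u, v)\<close>.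
  When \<open>T = Id + t N\<close> is invertible it follows by transport from \<open>T [u, v]\<^sub>t = [T u, T v]\<close>, but
  \<open>T\<close> may be singular for some \<open>t\<close>, and over a finite field it may be singular for every
  nonzero \<open>t\<close>. The argument below is therefore a direct expansion. By the Nijenhuis identity, the
  coefficients of \<open>t\<close> and \<open>t\<^sup>2\<close> in \<open>[\<alpha> x, [y, z]\<^sub>t]\<^sub>t\<close> are
  \<open>N\<close>-polarisations of \<open>K\<close>: \<open>N\<close> is inserted at one or two of the arguments, with powers of
  \<open>N\<close> applied outside (lemma \<open>deformed_nested_bracket\<close>).
  Hence the signed cyclic sum of \<open>[\<alpha> x, [y, z]\<^sub>t]\<^sub>t\<close> is a combination of values of \<open>J\<close>
  at homogeneous arguments of unchanged degrees, and of their images under \<open>N\<close>; all of these vanish.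

  Triviality holds because the Nijenhuis identity is the \<open>t\<^sup>2\<close>-coefficient of
  \<open>T [u, v]\<^sub>t = [T u, T v]\<close>, while the lower coefficients agree by the definition of \<open>\<psi>\<close>.
\<close>

locale even_hom_Nijenhuis = regular_hom_Lie_superalgebra scale V br \<alpha>
  for scale :: "'k::field \<Rightarrow> 'v::ab_group_add \<Rightarrow> 'v"
    and V :: "bit \<Rightarrow> 'v set"
    and br :: "'v \<Rightarrow> 'v \<Rightarrow> 'v"
    and \<alpha> :: "'v \<Rightarrow> 'v" +
  fixes N :: "'v \<Rightarrow> 'v"
  assumes Nijenhuis: "hom_Nijenhuis scale br \<alpha> N"
    and N_even: "map_of_degree V 0 N"
begin

lemma N_linear: "Vector_Spaces.linear scale scale N"
  and N_commute: "\<alpha> (N u) = N (\<alpha> u)"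
  and N_bracket: "br (N u) (N v) = N (br (N u) v) + N (br u (N v)) - N (N (br u v))"
proof -
  show l: "Vector_Spaces.linear scale scale N" and "\<alpha> (N u) = N (\<alpha> u)"
    using Nijenhuis by (auto simp: hom_Nijenhuis_def cochains1_def)
  interpret N: Vector_Spaces.linear scale scale N by (rule l)
  show "br (N u) (N v) = N (br (N u) v) + N (br u (N v)) - N (N (br u v))"
    using Nijenhuis by (simp add: hom_Nijenhuis_def nijenhuis_bracket_def N.add N.diff)
qed

sublocale N: Vector_Spaces.linear scale scale N by (rule N_linear)

sublocale \<alpha>: Vector_Spaces.linear scale scale \<alpha> by (rule \<alpha>_linear)

lemma N_homogeneous: "u \<in> V i \<Longrightarrow> N u \<in> V i"
  using N_even unfolding map_of_degree_def add_0 by blast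

lemma br_linear_right: "Vector_Spaces.linear scale scale (\<lambda>v. br u v)"
  and br_linear_left: "Vector_Spaces.linear scale scale (\<lambda>u. br u v)"
  using br_bilinear by (auto simp: bilinear_op_def)

lemma br_add_right: "br u (v + w) = br u v + br u w"
  and br_diff_right: "br u (v - w) = br u v - br u w"
  and br_scale_right: "br u (scale c v) = scale c (br u v)"
  and br_zero_right: "br u 0 = 0"
proof -
  interpret r: Vector_Spaces.linear scale scale "\<lambda>v. br u v" by (rule br_linear_right)
  show "br u (v + w) = br u v + br u w" "br u (v - w) = br u v - br u w"
    "br u (scale c v) = scale c (br u v)" "br u 0 = 0"
    by (rule r.add r.diff r.scale r.zero)+
qed

lemma br_add_left: "br (u + w) v = br u v + br w v"
  and br_diff_left: "br (u - w) v = br u v - br w v"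
  and br_scale_left: "br (scale c u) v = scale c (br u v)"
  and br_zero_left: "br 0 v = 0"
proof -
  interpret l: Vector_Spaces.linear scale scale "\<lambda>u. br u v" by (rule br_linear_left)
  show "br (u + w) v = br u v + br w v" "br (u - w) v = br u v - br w v"
    "br (scale c u) v = scale c (br u v)" "br 0 v = 0"
    by (rule l.add l.diff l.scale l.zero)+
qed

lemmas br_simps = br_add_right br_diff_right br_scale_right br_zero_right
  br_add_left br_diff_left br_scale_left br_zero_left

lemma br_skewD: "u \<in> V i \<Longrightarrow> v \<in> V j \<Longrightarrow> br u v = - scale (ksign (i * j)) (br v u)"
  using br_skew unfolding super_skew_def by blast

abbreviation \<psi> :: "'v \<Rightarrow> 'v \<Rightarrow> 'v" where
  "\<psi> \<equiv> nijenhuis_bracket br N"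

abbreviation br_t :: "'k \<Rightarrow> 'v \<Rightarrow> 'v \<Rightarrow> 'v" where
  "br_t t \<equiv> deformed_bracket scale br \<psi> t"

text \<open>As \<open>N u\<close> has the degree of \<open>u\<close>, skew-symmetry turns the middle term of the coboundary
  into \<open>[N u, v]\<close>.\<close>

lemma coboundary_hom_eq:
  assumes "u \<in> V i" "v \<in> V j"
  shows "coboundary_hom scale br 0 i j N u v = \<psi> u v"
proof -
  have "ksign (0 * i) = (1 :: 'k)" by (simp add: ksign_def)
  then show ?thesis
    unfolding coboundary_hom_def nijenhuis_bracket_def add_0
      br_skewD[OF N_homogeneous[OF assms(1)] assms(2)]
    by simp
qed

lemma coboundary_eq: "coboundary scale V br N = \<psi>"
proof (intro ext)
  fix u v
  obtain a b where ab: "a \<in> V 0" "b \<in> V 1" "u = a + b" using V_decompose by blast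
  obtain c d where cd: "c \<in> V 0" "d \<in> V 1" "v = c + d" using V_decompose by blast
  have "component V 0 u = a" "component V 1 u = b" "component V 0 v = c" "component V 1 v = d"
    using ab cd by (auto intro: component_unique)
  moreover have "map_component V 0 N = N" "map_component V 1 N = (\<lambda>u. 0)"
    using map_component_homogeneous[OF N_linear N_even] by simp_all
  moreover have "coboundary_hom scale br 1 i j (\<lambda>u. 0) x y = 0" for i j x y
    by (simp add: coboundary_hom_def br_simps)
  ultimately have "coboundary scale V br N u v = \<psi> a c + \<psi> a d + (\<psi> b c + \<psi> b d)"
    using ab cd by (simp add: coboundary_def coboundary_hom_eq)
  also have "\<dots> = \<psi> u v"
    by (simp add: nijenhuis_bracket_def ab(3) cd(3) br_simps N.add algebra_simps)
  finally show "coboundary scale V br N u v = \<psi> u v" .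
qed

lemma \<psi>_bilinear: "bilinear_op scale \<psi>"
  unfolding bilinear_op_def
proof (intro conjI allI)
  show "Vector_Spaces.linear scale scale (\<lambda>v. \<psi> u v)" for u
    by unfold_locales (simp_all add: nijenhuis_bracket_def br_simps N.add N.scale algebra_simps)
  show "Vector_Spaces.linear scale scale (\<lambda>u. \<psi> u v)" for v
    by unfold_locales (simp_all add: nijenhuis_bracket_def br_simps N.add N.scale algebra_simps)
qed

lemma \<psi>_skew: "super_skew scale V \<psi>"
  unfolding super_skew_def
proof (intro allI ballI)
  fix i j u v assume uv: "u \<in> V i" "v \<in> V j"
  have "\<psi> u v = - scale (ksign (i * j)) (br v (N u)) - scale (ksign (i * j)) (br (N v) u)
      + scale (ksign (i * j)) (N (br v u))"
    using br_skewD[OF N_homogeneous[OF uv(1)] uv(2)] br_skewD[OF uv(1) N_homogeneous[OF uv(2)]]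
      br_skewD[OF uv]
    by (simp add: nijenhuis_bracket_def N.neg N.scale)
  then show "\<psi> u v = - scale (ksign (i * j)) (\<psi> v u)"
    by (simp add: nijenhuis_bracket_def scale_right_distrib scale_right_diff_distrib)
qed

lemma \<psi>_even: "u \<in> V i \<Longrightarrow> v \<in> V j \<Longrightarrow> \<psi> u v \<in> V (i + j)"
  unfolding nijenhuis_bracket_def
  by (intro subspace_diff[OF subspace_V] subspace_add[OF subspace_V] br_even N_homogeneous)

lemma \<psi>_mult: "\<alpha> (\<psi> u v) = \<psi> (\<alpha> u) (\<alpha> v)"
  by (simp add: nijenhuis_bracket_def \<alpha>.add \<alpha>.diff \<alpha>_mult N_commute)

lemma \<psi>_cochain: "\<psi> \<in> cochains2 scale V \<alpha>"
  by (simp add: cochains2_def \<psi>_bilinear \<psi>_skew \<psi>_mult)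

definition K :: "'v \<Rightarrow> 'v \<Rightarrow> 'v \<Rightarrow> 'v" where
  "K x y z = br (\<alpha> x) (br y z)"

definition J :: "bit \<Rightarrow> bit \<Rightarrow> bit \<Rightarrow> 'v \<Rightarrow> 'v \<Rightarrow> 'v \<Rightarrow> 'v" where
  "J i j k x y z = scale (ksign (i * k)) (K x y z) + scale (ksign (j * i)) (K y z x)
     + scale (ksign (k * j)) (K z x y)"

lemma J_zero: "x \<in> V i \<Longrightarrow> y \<in> V j \<Longrightarrow> z \<in> V k \<Longrightarrow> J i j k x y z = 0"
  unfolding J_def K_def by (rule hom_Jacobi)

text \<open>
  In the coefficient of \<open>t\<close>, the two occurrences of \<open>[\<alpha> x, N [y, z]]\<close>, one from the inner and one
  from the outer \<open>\<psi>\<close>, cancel. In the coefficient of \<open>t\<^sup>2\<close>, which is \<open>\<psi>(\<alpha> x, \<psi>(y, z))\<close>, the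
  Nijenhuis identity is used twice: it turns \<open>[\<alpha> x, N \<psi>(y, z)]\<close> into \<open>K x (N y) (N z)\<close>, and applied
  to \<open>[N \<alpha> x, N [y, z]]\<close> it removes the remaining term \<open>N [\<alpha> x, N [y, z]]\<close>.
\<close>

lemma deformed_nested_bracket:
  "br_t t (\<alpha> x) (br_t t y z) = K x y z
     + scale t (K (N x) y z + K x (N y) z + K x y (N z) - N (K x y z))
     + scale (t * t) (K (N x) (N y) z + K (N x) y (N z) + K x (N y) (N z)
         - N (K (N x) y z + K x (N y) z + K x y (N z)) + N (N (K x y z)))"
proof -
  have t1: "br (\<alpha> x) (\<psi> y z) + \<psi> (\<alpha> x) (br y z)
      = K (N x) y z + K x (N y) z + K x y (N z) - N (K x y z)"
    by (simp add: nijenhuis_bracket_def K_def br_simps N_commute algebra_simps)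
  have inner: "N (\<psi> y z) = br (N y) (N z)"
    by (simp add: nijenhuis_bracket_def N_bracket N.add N.diff)
  have "\<psi> (\<alpha> x) (\<psi> y z)
      = br (N (\<alpha> x)) (\<psi> y z) + br (\<alpha> x) (br (N y) (N z)) - N (br (\<alpha> x) (\<psi> y z))"
    unfolding nijenhuis_bracket_def[of br N "\<alpha> x"] inner ..
  also have "\<dots> = K (N x) (N y) z + K (N x) y (N z) + K x (N y) (N z)
         - N (K (N x) y z + K x (N y) z + K x y (N z)) + N (N (K x y z))"
    by (simp add: nijenhuis_bracket_def K_def br_simps N_commute N.add N.diff
        N_bracket[of "\<alpha> x" "br y z"])
  finally have t2: "\<psi> (\<alpha> x) (\<psi> y z) = \<dots>" .
  have "\<psi> a (scale t b) = scale t (\<psi> a b)" "\<psi> a (b + c) = \<psi> a b + \<psi> a c" for a b c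
    by (simp_all add: nijenhuis_bracket_def br_simps N.add N.scale
        scale_right_distrib scale_right_diff_distrib)
  then have "br_t t (\<alpha> x) (br_t t y z) = br (\<alpha> x) (br y z)
      + scale t (br (\<alpha> x) (\<psi> y z) + \<psi> (\<alpha> x) (br y z)) + scale (t * t) (\<psi> (\<alpha> x) (\<psi> y z))"
    by (simp add: deformed_bracket_def br_simps scale_right_distrib)
  then show ?thesis unfolding t1 t2 by (simp add: K_def)
qed

text \<open>
  The signs depend on the degrees \<open>i, j, k\<close> alone, and these stay fixed when \<open>N\<close> is inserted at an
  argument. So each group of insertions in \<open>deformed_nested_bracket\<close>, being symmetric in the three
  positions, sums to a group of values of \<open>J\<close> with the same signs.
\<close>

lemma deformed_Jacobiator:
  "scale (ksign (i * k)) (br_t t (\<alpha> x) (br_t t y z))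
     + scale (ksign (j * i)) (br_t t (\<alpha> y) (br_t t z x))
     + scale (ksign (k * j)) (br_t t (\<alpha> z) (br_t t x y)) =
   J i j k x y z
     + scale t (J i j k (N x) y z + J i j k x (N y) z + J i j k x y (N z) - N (J i j k x y z))
     + scale (t * t) (J i j k (N x) (N y) z + J i j k (N x) y (N z) + J i j k x (N y) (N z)
         - N (J i j k (N x) y z + J i j k x (N y) z + J i j k x y (N z))
         + N (N (J i j k x y z)))"
proof -
  let ?S = "\<lambda>a b c. scale (ksign (i * k)) a + scale (ksign (j * i)) b + scale (ksign (k * j)) c"
  have S_add: "?S (a + a') (b + b') (c + c') = ?S a b c + ?S a' b' c'" for a a' b b' c c'
    by (simp add: scale_right_distrib)
  have S_diff: "?S (a - a') (b - b') (c - c') = ?S a b c - ?S a' b' c'" for a a' b b' c c'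
    by (simp add: scale_right_diff_distrib)
  have S_scale: "?S (scale r a) (scale r b) (scale r c) = scale r (?S a b c)" for r a b c
    by (simp add: scale_right_distrib mult.commute)
  have S_N: "?S (N a) (N b) (N c) = N (?S a b c)" for a b c
    by (simp add: N.add N.scale)
  have expand: "?S (a + scale t (b - N a) + scale (t * t) (c - N b + N (N a)))
      (a' + scale t (b' - N a') + scale (t * t) (c' - N b' + N (N a')))
      (a'' + scale t (b'' - N a'') + scale (t * t) (c'' - N b'' + N (N a'')))
    = ?S a a' a'' + scale t (?S b b' b'' - N (?S a a' a''))
      + scale (t * t) (?S c c' c'' - N (?S b b' b'') + N (N (?S a a' a'')))"
    for a a' a'' b b' b'' c c' c''
    unfolding S_add S_diff S_scale S_N ..
  have one: "?S (K (N x) y z + K x (N y) z + K x y (N z)) (K (N y) z x + K y (N z) x + K y z (N x))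
      (K (N z) x y + K z (N x) y + K z x (N y))
      = J i j k (N x) y z + J i j k x (N y) z + J i j k x y (N z)"
    by (simp add: J_def scale_right_distrib add_ac)
  have two: "?S (K (N x) (N y) z + K (N x) y (N z) + K x (N y) (N z))
      (K (N y) (N z) x + K (N y) z (N x) + K y (N z) (N x))
      (K (N z) (N x) y + K (N z) x (N y) + K z (N x) (N y))
      = J i j k (N x) (N y) z + J i j k (N x) y (N z) + J i j k x (N y) (N z)"
    by (simp add: J_def scale_right_distrib add_ac)
  show ?thesis
    unfolding deformed_nested_bracket expand one two J_def[of i j k x y z, symmetric] ..
qed

lemma deformed_regular: "regular_hom_Lie_superalgebra scale V (br_t t) \<alpha>"
proof unfold_locales
  show "bilinear_op scale (br_t t)"
    unfolding bilinear_op_def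
  proof (intro conjI allI)
    show "Vector_Spaces.linear scale scale (\<lambda>v. br_t t u v)" for u
      by unfold_locales (simp_all add: deformed_bracket_def nijenhuis_bracket_def br_simps
          N.add N.scale algebra_simps)
    show "Vector_Spaces.linear scale scale (\<lambda>u. br_t t u v)" for v
      by unfold_locales (simp_all add: deformed_bracket_def nijenhuis_bracket_def br_simps
          N.add N.scale algebra_simps)
  qed
  show "br_t t u v \<in> V (i + j)" if "u \<in> V i" "v \<in> V j" for u v i j
    unfolding deformed_bracket_def
    by (intro subspace_add[OF subspace_V] subspace_scale[OF subspace_V] br_even \<psi>_even that)
  show "super_skew scale V (br_t t)"
    unfolding super_skew_def
  proof (intro allI ballI)
    fix i j u v assume uv: "u \<in> V i" "v \<in> V j"
    have "\<psi> u v = - scale (ksign (i * j)) (\<psi> v u)"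
      using \<psi>_skew uv unfolding super_skew_def by blast
    with br_skewD[OF uv] show "br_t t u v = - scale (ksign (i * j)) (br_t t v u)"
      by (simp add: deformed_bracket_def scale_right_distrib mult.commute)
  qed
  show "scale (ksign (i * k)) (br_t t (\<alpha> x) (br_t t y z))
     + scale (ksign (j * i)) (br_t t (\<alpha> y) (br_t t z x))
     + scale (ksign (k * j)) (br_t t (\<alpha> z) (br_t t x y)) = 0"
    if "x \<in> V i" "y \<in> V j" "z \<in> V k" for x y z i j k
    unfolding deformed_Jacobiator using that by (simp add: J_zero N_homogeneous N.zero)
  show "\<alpha> (br_t t u v) = br_t t (\<alpha> u) (\<alpha> v)" for u v
    by (simp add: deformed_bracket_def \<alpha>.add \<alpha>.scale \<alpha>_mult \<psi>_mult)
qed (fact \<alpha>_even \<alpha>_bij)+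

lemma deformation_trivial: "trivial_deformation scale br \<alpha> \<psi>"
  unfolding trivial_deformation_def Let_def
proof (intro bexI[of _ N] allI)
  show "N \<in> cochains1 scale \<alpha>" using Nijenhuis by (simp add: hom_Nijenhuis_def)
  fix t u v
  have order2: "N (\<psi> u v) = br (N u) (N v)"
    using Nijenhuis by (simp add: hom_Nijenhuis_def)
  have order1: "\<psi> u v + N (br u v) = br (N u) v + br u (N v)"
    by (simp add: nijenhuis_bracket_def)
  have "br_t t u v + scale t (N (br_t t u v))
      = br u v + scale t (\<psi> u v + N (br u v)) + scale (t * t) (N (\<psi> u v))"
    by (simp add: deformed_bracket_def N.add N.scale scale_right_distrib add_ac)
  also have "\<dots> = br (u + scale t (N u)) (v + scale t (N v))"
    unfolding order1 order2 by (simp add: br_simps scale_right_distrib add_ac)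
  finally show "br_t t u v + scale t (N (br_t t u v))
      = br (u + scale t (N u)) (v + scale t (N v))" .
qed

end

theorem theorem3p4:
  fixes scale :: "'k::field \<Rightarrow> 'v::ab_group_add \<Rightarrow> 'v"
    and V :: "bit \<Rightarrow> 'v set"
    and br :: "'v \<Rightarrow> 'v \<Rightarrow> 'v"
    and \<alpha> N :: "'v \<Rightarrow> 'v"
  assumes "regular_hom_Lie_superalgebra scale V br \<alpha>"
    and "hom_Nijenhuis scale br \<alpha> N"
    and "map_of_degree V 0 N"
  shows "(\<forall>u v. coboundary scale V br N u v = nijenhuis_bracket br N u v) \<and>
    generates_deformation scale V br \<alpha> (coboundary scale V br N) \<and>
    trivial_deformation scale br \<alpha> (coboundary scale V br N)"
proof -
  interpret even_hom_Nijenhuis scale V br \<alpha> N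
    using assms by (intro even_hom_Nijenhuis.intro even_hom_Nijenhuis_axioms.intro)
  show ?thesis
    by (simp add: coboundary_eq generates_deformation_def \<psi>_cochain deformed_regular
        deformation_trivial)
qed

end
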